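(* Let $k$ be a $\sigma$-ring, let $\mathcal{G}$ be an algebraic group over $k^\sharp$, that is, an affine group scheme of finite type over $k^\sharp$, and let $G$ be the corresponding $\sigma$-algebraic group over $k$, i.e. $G(R)=\mathcal{G}(R^\sharp)$ for every $k$-$\sigma$-algebra $R$. Then $$\mathrm{H}^1_\sigma(A/k,G)=\mathrm{H}^1(A^\sharp/k^\sharp,\mathcal{G})$$ for every $k$-$\sigma$-algebra $A$.
   Context: All rings are commutative with $1$. A $\sigma$-ring is a ring with a ring endomorphism $\sigma$; a $k$-$\sigma$-algebra is a $\sigma$-ring $R$ with a ring homomorphism $k\to R$ commuting with $\sigma$. Tensor products carry $\sigma(r\otimes s)=\sigma(r)\otimes\sigma(s)$. $R^\sharp$ denotes the ring (or $k$-algebra) obtained from $R$ by forgetting $\sigma$. A $\sigma$-algebraic group over $k$ is a group-valued functor on $k$-$\sigma$-algebras representable by a $k$-$\sigma$-algebra that is finitely $\sigma$-generated (generated as a $k$-algebra by the $\sigma^i(b)$, $i\ge0$, $b\in B$, for some finite set $B$). For a $k$-$\sigma$-algebra $A$ let $\delta_1,\delta_2\colon G(A)\to G(A\otimes_k A)$ be induced by $a\mapsto 1\otimes a$ and $a\mapsto a\otimes 1$, and let $\partial_1,\partial_2,\partial_3\colon G(A\otimes_k A)\to G(A\otimes_k A\otimes_k A)$ be induced by $a\otimes b\mapsto 1\otimes a\otimes b$, $a\otimes b\mapsto a\otimes 1\otimes b$ and $a\otimes b\mapsto a\otimes b\otimes 1$. Put $\mathrm{Z}^1_\sigma(A/k,G)=\{\chi\in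 G(A\otimes_kA)\mid \partial_2(\chi)=\partial_1(\chi)\partial_3(\chi)\}$, call $\chi_1,\chi_2$ equivalent if $\chi_1=\delta_1(\alpha)\chi_2\delta_2(\alpha)^{-1}$ for some $\alpha\in G(A)$, and let $\mathrm{H}^1_\sigma(A/k,G)$ be the set of equivalence classes, pointed by the class of $1$. $\mathrm{H}^1(A^\sharp/k^\sharp,\mathcal{G})$ is defined in the same way: cocycles are $\chi\in\mathcal{G}(A^\sharp\otimes_{k^\sharp}A^\sharp)$ with $\partial_2^\sharp(\chi)=\partial_1^\sharp(\chi)\partial_3^\sharp(\chi)$ in $\mathcal{G}(A^\sharp\otimes_{k^\sharp}A^\sharp\otimes_{k^\sharp}A^\sharp)$, and $\chi,\tilde\chi$ are equivalent if $\tilde\chi=\delta_1^\sharp(\alpha)\chi\delta_2^\sharp(\alpha)^{-1}$ for some $\alpha\in\mathcal{G}(A^\sharp)$, where $\delta_i^\sharp,\partial_i^\sharp$ are induced by the same ring maps. *)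

theory Defs
  imports "HOL-Library.Poly_Mapping" "HOL-Algebra.Algebra"
begin

text \<open>
  HOL has no quantification over all types, so the categories of \<open>k\<close>-algebras and
  \<open>k\<close>-\<open>\<sigma>\<close>-algebras are formed inside a universe: a type \<open>'a\<close>, assumed infinite, in which the
  base ring and all algebras have their carriers.  Functors are defined on algebras in
  \<open>'a\<close>.  Tensor products are formed as usual and then copied back into \<open>'a\<close>, which is possible
  because \<open>'a\<close> is infinite.  Morphisms are extensional functions, so that equality of
  morphisms is equality on the carrier.
\<close>

section \<open>Rings and algebras with an endomorphism\<close>

record 'a sring = "'a ring" +
  endo :: "'a \<Rightarrow> 'a"

record 'a alg = "'a ring" +
  str :: "'a \<Rightarrow> 'a"

record 'a salg = "'a alg" +
  sig :: "'a \<Rightarrow> 'a"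

abbreviation ring_sharp :: "('a, 'm) ring_scheme \<Rightarrow> 'a ring"
  where "ring_sharp \<equiv> ring.truncate"

abbreviation alg_sharp :: "('a, 'm) alg_scheme \<Rightarrow> 'a alg"
  where "alg_sharp \<equiv> alg.truncate"

definition sigma_ring :: "('a, 'm) sring_scheme \<Rightarrow> bool"
  where "sigma_ring k \<longleftrightarrow> cring k \<and> endo k \<in> ring_hom k k"

definition k_algebra :: "('a, 'm) ring_scheme \<Rightarrow> ('a, 'n) alg_scheme \<Rightarrow> bool"
  where "k_algebra k R \<longleftrightarrow> cring R \<and> str R \<in> ring_hom k R"

definition k_sigma_algebra :: "('a, 'm) sring_scheme \<Rightarrow> ('a, 'n) salg_scheme \<Rightarrow> bool"
  where "k_sigma_algebra k R \<longleftrightarrow>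
    k_algebra k R \<and> sig R \<in> ring_hom R R \<and>
    (\<forall>c \<in> carrier k. str R (endo k c) = sig R (str R c))"

definition alg_hom :: "('a, 'm) ring_scheme \<Rightarrow> ('a, 'n) alg_scheme \<Rightarrow> ('a, 'p) alg_scheme \<Rightarrow> ('a \<Rightarrow> 'a) set"
  where "alg_hom k R S =
    {f \<in> ring_hom R S \<inter> extensional (carrier R). \<forall>c \<in> carrier k. f (str R c) = str S c}"

definition sigma_alg_hom :: "('a, 'm) ring_scheme \<Rightarrow> ('a, 'n) salg_scheme \<Rightarrow> ('a, 'p) salg_scheme \<Rightarrow> ('a \<Rightarrow> 'a) set"
  where "sigma_alg_hom k R S = {f \<in> alg_hom k R S. \<forall>r \<in> carrier R. f (sig R r) = sig S (f r)}"

definition finitely_generated :: "('a, 'm) ring_scheme \<Rightarrow> ('a, 'n) alg_scheme \<Rightarrow> bool"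
  where "finitely_generated k R \<longleftrightarrow>
    (\<exists>B. finite B \<and> B \<subseteq> carrier R \<and> generate_ring R (str R ` carrier k \<union> B) = carrier R)"

definition finitely_sigma_generated :: "('a, 'm) ring_scheme \<Rightarrow> ('a, 'n) salg_scheme \<Rightarrow> bool"
  where "finitely_sigma_generated k R \<longleftrightarrow>
    (\<exists>B. finite B \<and> B \<subseteq> carrier R \<and>
      generate_ring R (str R ` carrier k \<union> {(sig R ^^ i) b | i b. b \<in> B}) = carrier R)"

section \<open>Group-valued functors\<close>

record ('o, 'a, 'g) grp_functor =
  ob :: "'o \<Rightarrow> 'g monoid"
  mor :: "'o \<Rightarrow> 'o \<Rightarrow> ('a \<Rightarrow> 'a) \<Rightarrow> 'g \<Rightarrow> 'g"

text \<open>The category is given by its objects \<open>Ob\<close> and its hom-sets \<open>Hm R S\<close>.\<close>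

definition group_valued_functor ::
  "(('a, 'm) partial_object_scheme \<Rightarrow> bool) \<Rightarrow>
   (('a, 'm) partial_object_scheme \<Rightarrow> ('a, 'm) partial_object_scheme \<Rightarrow> ('a \<Rightarrow> 'a) set) \<Rightarrow>
   (('a, 'm) partial_object_scheme, 'a, 'g) grp_functor \<Rightarrow> bool"
  where "group_valued_functor Ob Hm F \<longleftrightarrow>
    (\<forall>R. Ob R \<longrightarrow> group (ob F R)) \<and>
    (\<forall>R S f. Ob R \<longrightarrow> Ob S \<longrightarrow> f \<in> Hm R S \<longrightarrow> mor F R S f \<in> hom (ob F R) (ob F S)) \<and>
    (\<forall>R. Ob R \<longrightarrow> (\<forall>x \<in> carrier (ob F R). mor F R R (\<lambda>r \<in> carrier R. r) x = x)) \<and>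
    (\<forall>R S T f g. Ob R \<longrightarrow> Ob S \<longrightarrow> Ob T \<longrightarrow> f \<in> Hm R S \<longrightarrow> g \<in> Hm S T \<longrightarrow>
      (\<forall>x \<in> carrier (ob F R).
        mor F R T (compose (carrier R) g f) x = mor F S T g (mor F R S f x)))"

text \<open>The bijections \<open>\<theta> R\<close> form a natural isomorphism from \<open>Hm H\<close> to the
  underlying set-valued functor of \<open>F\<close>.\<close>

definition represented_by ::
  "(('a, 'm) partial_object_scheme \<Rightarrow> bool) \<Rightarrow>
   (('a, 'm) partial_object_scheme \<Rightarrow> ('a, 'm) partial_object_scheme \<Rightarrow> ('a \<Rightarrow> 'a) set) \<Rightarrow>
   (('a, 'm) partial_object_scheme, 'a, 'g) grp_functor \<Rightarrow> ('a, 'm) partial_object_scheme \<Rightarrow> bool"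
  where "represented_by Ob Hm F H \<longleftrightarrow> Ob H \<and>
    (\<exists>\<theta>. (\<forall>R. Ob R \<longrightarrow> bij_betw (\<theta> R) (Hm H R) (carrier (ob F R))) \<and>
         (\<forall>R S f h. Ob R \<longrightarrow> Ob S \<longrightarrow> f \<in> Hm R S \<longrightarrow> h \<in> Hm H R \<longrightarrow>
            mor F R S f (\<theta> R h) = \<theta> S (compose (carrier H) f h)))"

text \<open>An affine group scheme of finite type over \<open>k\<close>, given by its functor of points.\<close>

definition algebraic_group :: "('a, 'm) ring_scheme \<Rightarrow> ('a alg, 'a, 'g) grp_functor \<Rightarrow> bool"
  where "algebraic_group k F \<longleftrightarrow>
    group_valued_functor (k_algebra k) (alg_hom k) F \<and>
    (\<exists>H. represented_by (k_algebra k) (alg_hom k) F H \<and> finitely_generated k H)"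

definition sigma_algebraic_group :: "('a, 'm) sring_scheme \<Rightarrow> ('a salg, 'a, 'g) grp_functor \<Rightarrow> bool"
  where "sigma_algebraic_group k F \<longleftrightarrow>
    group_valued_functor (k_sigma_algebra k) (sigma_alg_hom k) F \<and>
    (\<exists>H. represented_by (k_sigma_algebra k) (sigma_alg_hom k) F H \<and> finitely_sigma_generated k H)"

section \<open>Tensor products\<close>

text \<open>
  The ring \<open>\<int>[A \<times> B]\<close>: the free abelian group on \<open>A \<times> B\<close>, with the multiplication that is
  \<open>(a, b) (a', b') = (a a', b b')\<close> on the basis.  The subgroup generated by \<open>tensor_rels\<close>
  is an ideal of this ring, because a basis element times a relation is again a relation;
  so \<open>tensor_quot\<close> is the usual quotient of the free abelian group.
\<close>

definition free_prod_ring :: "('a, 'm) ring_scheme \<Rightarrow> ('a, 'n) ring_scheme \<Rightarrow> ('a \<times> 'a \<Rightarrow>\<^sub>0 int) ring"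
  where "free_prod_ring A B =
    \<lparr>carrier = {x. Poly_Mapping.keys x \<subseteq> carrier A \<times> carrier B},
     monoid.mult = (\<lambda>x y. frag_extend (\<lambda>(a, b). frag_extend (\<lambda>(a', b').
               frag_of (a \<otimes>\<^bsub>A\<^esub> a', b \<otimes>\<^bsub>B\<^esub> b')) y) x),
     monoid.one = frag_of (\<one>\<^bsub>A\<^esub>, \<one>\<^bsub>B\<^esub>),
     ring.zero = 0,
     ring.add = (+)\<rparr>"

definition tensor_rels ::
  "('a, 'm) ring_scheme \<Rightarrow> ('a, 'n) alg_scheme \<Rightarrow> ('a, 'p) alg_scheme \<Rightarrow> ('a \<times> 'a \<Rightarrow>\<^sub>0 int) set"
  where "tensor_rels k A B =
    {frag_of (a \<oplus>\<^bsub>A\<^esub> a', b) - frag_of (a, b) - frag_of (a', b) | a a' b.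
       a \<in> carrier A \<and> a' \<in> carrier A \<and> b \<in> carrier B} \<union>
    {frag_of (a, b \<oplus>\<^bsub>B\<^esub> b') - frag_of (a, b) - frag_of (a, b') | a b b'.
       a \<in> carrier A \<and> b \<in> carrier B \<and> b' \<in> carrier B} \<union>
    {frag_of (str A c \<otimes>\<^bsub>A\<^esub> a, b) - frag_of (a, str B c \<otimes>\<^bsub>B\<^esub> b) | c a b.
       c \<in> carrier k \<and> a \<in> carrier A \<and> b \<in> carrier B}"

definition tensor_ideal ::
  "('a, 'm) ring_scheme \<Rightarrow> ('a, 'n) alg_scheme \<Rightarrow> ('a, 'p) alg_scheme \<Rightarrow> ('a \<times> 'a \<Rightarrow>\<^sub>0 int) set"
  where "tensor_ideal k A B = Idl\<^bsub>free_prod_ring A B\<^esub> (tensor_rels k A B)"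

definition tensor_quot ::
  "('a, 'm) ring_scheme \<Rightarrow> ('a, 'n) alg_scheme \<Rightarrow> ('a, 'p) alg_scheme \<Rightarrow> ('a \<times> 'a \<Rightarrow>\<^sub>0 int) set ring"
  where "tensor_quot k A B = free_prod_ring A B Quot tensor_ideal k A B"

text \<open>A chosen injection of the tensor product into the universe \<open>'a\<close>; one exists when
  \<open>'a\<close> is infinite.\<close>

definition tensor_code ::
  "('a, 'm) ring_scheme \<Rightarrow> ('a, 'n) alg_scheme \<Rightarrow> ('a, 'p) alg_scheme \<Rightarrow> ('a \<times> 'a \<Rightarrow>\<^sub>0 int) set \<Rightarrow> 'a"
  where "tensor_code k A B = (SOME h. inj_on h (carrier (tensor_quot k A B)))"

definition tensor_decode ::
  "('a, 'm) ring_scheme \<Rightarrow> ('a, 'n) alg_scheme \<Rightarrow> ('a, 'p) alg_scheme \<Rightarrow> 'a \<Rightarrow> ('a \<times> 'a \<Rightarrow>\<^sub>0 int) set"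
  where "tensor_decode k A B = inv_into (carrier (tensor_quot k A B)) (tensor_code k A B)"

definition pure_tensor ::
  "('a, 'm) ring_scheme \<Rightarrow> ('a, 'n) alg_scheme \<Rightarrow> ('a, 'p) alg_scheme \<Rightarrow> 'a \<Rightarrow> 'a \<Rightarrow> 'a"
  where "pure_tensor k A B a b =
    tensor_code k A B (tensor_ideal k A B +>\<^bsub>free_prod_ring A B\<^esub> frag_of (a, b))"

definition tensor :: "('a, 'm) ring_scheme \<Rightarrow> ('a, 'n) alg_scheme \<Rightarrow> ('a, 'p) alg_scheme \<Rightarrow> 'a alg"
  where "tensor k A B =
    \<lparr>carrier = tensor_code k A B ` carrier (tensor_quot k A B),
     monoid.mult = (\<lambda>x y. tensor_code k A B
               (tensor_decode k A B x \<otimes>\<^bsub>tensor_quot k A B\<^esub> tensor_decode k A B y)),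
     monoid.one = tensor_code k A B \<one>\<^bsub>tensor_quot k A B\<^esub>,
     ring.zero = tensor_code k A B \<zero>\<^bsub>tensor_quot k A B\<^esub>,
     ring.add = (\<lambda>x y. tensor_code k A B
               (tensor_decode k A B x \<oplus>\<^bsub>tensor_quot k A B\<^esub> tensor_decode k A B y)),
     str = (\<lambda>c. pure_tensor k A B (str A c) \<one>\<^bsub>B\<^esub>)\<rparr>"

text \<open>The ring map on the tensor product of \<open>A\<close> and \<open>B\<close> induced by \<open>a \<otimes> b \<mapsto> \<phi> a b\<close>.\<close>

definition induced ::
  "('a, 'm) ring_scheme \<Rightarrow> ('a, 'n) alg_scheme \<Rightarrow> ('a, 'p) alg_scheme \<Rightarrow> ('a, 'q) ring_scheme \<Rightarrow>
   ('a \<Rightarrow> 'a \<Rightarrow> 'a) \<Rightarrow> 'a \<Rightarrow> 'a"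
  where "induced k A B C \<phi> =
    (THE f. f \<in> ring_hom (tensor k A B) C \<inter> extensional (carrier (tensor k A B)) \<and>
       (\<forall>a \<in> carrier A. \<forall>b \<in> carrier B. f (pure_tensor k A B a b) = \<phi> a b))"

definition sigma_tensor ::
  "('a, 'm) ring_scheme \<Rightarrow> ('a, 'n) salg_scheme \<Rightarrow> ('a, 'p) salg_scheme \<Rightarrow> 'a salg"
  where "sigma_tensor k A B = alg.extend (tensor k A B)
    (salg.fields (induced k A B (tensor k A B) (\<lambda>a b. pure_tensor k A B (sig A a) (sig B b))))"

lemma alg_sharp_sigma_tensor:
  "alg_sharp (sigma_tensor k A B) = tensor (ring_sharp k) (alg_sharp A) (alg_sharp B)"
proof -
  have "alg_sharp (sigma_tensor k A B) = tensor k A B"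
    by (simp add: sigma_tensor_def alg.defs tensor_def)
  also have "\<dots> = tensor (ring_sharp k) (alg_sharp A) (alg_sharp B)"
    by (simp add: tensor_def pure_tensor_def tensor_code_def tensor_decode_def tensor_quot_def
        tensor_ideal_def tensor_rels_def free_prod_ring_def alg.defs ring.defs)
  finally show ?thesis .
qed

section \<open>Cohomology\<close>

text \<open>The triple tensor product is bracketed to the left.\<close>

abbreviation tensor2 :: "('a, 'm) ring_scheme \<Rightarrow> ('a, 'n) alg_scheme \<Rightarrow> 'a alg"
  where "tensor2 k A \<equiv> tensor k A A"

abbreviation tensor3 :: "('a, 'm) ring_scheme \<Rightarrow> ('a, 'n) alg_scheme \<Rightarrow> 'a alg"
  where "tensor3 k A \<equiv> tensor k (tensor2 k A) A"

abbreviation sigma_tensor2 :: "('a, 'm) ring_scheme \<Rightarrow> ('a, 'n) salg_scheme \<Rightarrow> 'a salg"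
  where "sigma_tensor2 k A \<equiv> sigma_tensor k A A"

abbreviation sigma_tensor3 :: "('a, 'm) ring_scheme \<Rightarrow> ('a, 'n) salg_scheme \<Rightarrow> 'a salg"
  where "sigma_tensor3 k A \<equiv> sigma_tensor k (sigma_tensor2 k A) A"

definition pure_tensor3 :: "('a, 'm) ring_scheme \<Rightarrow> ('a, 'n) alg_scheme \<Rightarrow> 'a \<Rightarrow> 'a \<Rightarrow> 'a \<Rightarrow> 'a"
  where "pure_tensor3 k A a b c = pure_tensor k (tensor2 k A) A (pure_tensor k A A a b) c"

definition d1 :: "('a, 'm) ring_scheme \<Rightarrow> ('a, 'n) alg_scheme \<Rightarrow> 'a \<Rightarrow> 'a"
  where "d1 k A = (\<lambda>a \<in> carrier A. pure_tensor k A A \<one>\<^bsub>A\<^esub> a)"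

definition d2 :: "('a, 'm) ring_scheme \<Rightarrow> ('a, 'n) alg_scheme \<Rightarrow> 'a \<Rightarrow> 'a"
  where "d2 k A = (\<lambda>a \<in> carrier A. pure_tensor k A A a \<one>\<^bsub>A\<^esub>)"

definition p1 :: "('a, 'm) ring_scheme \<Rightarrow> ('a, 'n) alg_scheme \<Rightarrow> 'a \<Rightarrow> 'a"
  where "p1 k A = induced k A A (tensor3 k A) (\<lambda>a b. pure_tensor3 k A \<one>\<^bsub>A\<^esub> a b)"

definition p2 :: "('a, 'm) ring_scheme \<Rightarrow> ('a, 'n) alg_scheme \<Rightarrow> 'a \<Rightarrow> 'a"
  where "p2 k A = induced k A A (tensor3 k A) (\<lambda>a b. pure_tensor3 k A a \<one>\<^bsub>A\<^esub> b)"

definition p3 :: "('a, 'm) ring_scheme \<Rightarrow> ('a, 'n) alg_scheme \<Rightarrow> 'a \<Rightarrow> 'a"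
  where "p3 k A = induced k A A (tensor3 k A) (\<lambda>a b. pure_tensor3 k A a b \<one>\<^bsub>A\<^esub>)"

definition Z1_sigma :: "('a, 'm) ring_scheme \<Rightarrow> 'a salg \<Rightarrow> ('a salg, 'a, 'g) grp_functor \<Rightarrow> 'g set"
  where "Z1_sigma k A G =
    (let \<mu> = mor G (sigma_tensor2 k A) (sigma_tensor3 k A) in
     {\<chi> \<in> carrier (ob G (sigma_tensor2 k A)).
        \<mu> (p2 k A) \<chi> = \<mu> (p1 k A) \<chi> \<otimes>\<^bsub>ob G (sigma_tensor3 k A)\<^esub> \<mu> (p3 k A) \<chi>})"

definition equiv_sigma :: "('a, 'm) ring_scheme \<Rightarrow> 'a salg \<Rightarrow> ('a salg, 'a, 'g) grp_functor \<Rightarrow> ('g \<times> 'g) set"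
  where "equiv_sigma k A G =
    (let G2 = ob G (sigma_tensor2 k A); \<delta> = mor G A (sigma_tensor2 k A) in
     {(\<chi>1, \<chi>2). \<chi>1 \<in> Z1_sigma k A G \<and> \<chi>2 \<in> Z1_sigma k A G \<and>
        (\<exists>\<alpha> \<in> carrier (ob G A).
           \<chi>1 = \<delta> (d1 k A) \<alpha> \<otimes>\<^bsub>G2\<^esub> \<chi>2 \<otimes>\<^bsub>G2\<^esub> inv\<^bsub>G2\<^esub> (\<delta> (d2 k A) \<alpha>))})"

text \<open>Pointed sets are pairs of a set and its base point.\<close>

definition H1_sigma ::
  "('a, 'm) ring_scheme \<Rightarrow> 'a salg \<Rightarrow> ('a salg, 'a, 'g) grp_functor \<Rightarrow> 'g set set \<times> 'g set"
  where "H1_sigma k A G =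
    (Z1_sigma k A G // equiv_sigma k A G,
     equiv_sigma k A G `` {\<one>\<^bsub>ob G (sigma_tensor2 k A)\<^esub>})"

definition Z1 :: "('a, 'm) ring_scheme \<Rightarrow> 'a alg \<Rightarrow> ('a alg, 'a, 'g) grp_functor \<Rightarrow> 'g set"
  where "Z1 k A G =
    (let \<mu> = mor G (tensor2 k A) (tensor3 k A) in
     {\<chi> \<in> carrier (ob G (tensor2 k A)).
        \<mu> (p2 k A) \<chi> = \<mu> (p1 k A) \<chi> \<otimes>\<^bsub>ob G (tensor3 k A)\<^esub> \<mu> (p3 k A) \<chi>})"

definition equiv_coc :: "('a, 'm) ring_scheme \<Rightarrow> 'a alg \<Rightarrow> ('a alg, 'a, 'g) grp_functor \<Rightarrow> ('g \<times> 'g) set"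
  where "equiv_coc k A G =
    (let G2 = ob G (tensor2 k A); \<delta> = mor G A (tensor2 k A) in
     {(\<chi>, \<chi>'). \<chi> \<in> Z1 k A G \<and> \<chi>' \<in> Z1 k A G \<and>
        (\<exists>\<alpha> \<in> carrier (ob G A).
           \<chi>' = \<delta> (d1 k A) \<alpha> \<otimes>\<^bsub>G2\<^esub> \<chi> \<otimes>\<^bsub>G2\<^esub> inv\<^bsub>G2\<^esub> (\<delta> (d2 k A) \<alpha>))})"

definition H1 ::
  "('a, 'm) ring_scheme \<Rightarrow> 'a alg \<Rightarrow> ('a alg, 'a, 'g) grp_functor \<Rightarrow> 'g set set \<times> 'g set"
  where "H1 k A G =
    (Z1 k A G // equiv_coc k A G,
     equiv_coc k A G `` {\<one>\<^bsub>ob G (tensor2 k A)\<^esub>})"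

end

theory Submission
  imports Defs
begin

text \<open>
  Both cohomology sets are cut out of \<open>ob G\<close> by the same formulas, evaluated on
  \<open>A\<close>, \<open>A \<otimes> A\<close> and \<open>A \<otimes> A \<otimes> A\<close>, so it suffices that \<open>G\<close> and \<open>\<G>\<close> agree on these
  objects and on the maps \<open>\<delta>\<^sub>i\<close>, \<open>\<partial>\<^sub>i\<close>.  As \<open>G\<close> is \<open>\<G>\<close> only on \<open>k\<close>-\<open>\<sigma>\<close>-algebras and \<open>\<sigma>\<close>-morphisms,
  the point is that \<open>a \<otimes> b \<mapsto> \<sigma>(a) \<otimes> \<sigma>(b)\<close> is a well-defined ring endomorphism commuting with
  these maps.  A ring map out of a tensor product is determined by its values on pure
  tensors, and exists as soon as they have the form \<open>f(a) g(b)\<close> for ring maps \<open>f\<close>, \<open>g\<close> agreeing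
  on \<open>k\<close>.  The two equivalence relations are converse to each other, hence equal by symmetry.
\<close>

section \<open>Tensor products of rings\<close>

text \<open>The axioms only mention the five ring fields. This carries the ring structure from
  \<open>tensor\<close> to \<open>sigma_tensor\<close>, a record of another type with one more
  field.\<close>

lemma cring_cong:
  assumes R: "cring R"
    and carrier: "carrier S = carrier R"
    and mult: "\<And>x y. x \<otimes>\<^bsub>S\<^esub> y = x \<otimes>\<^bsub>R\<^esub> y" and one: "\<one>\<^bsub>S\<^esub> = \<one>\<^bsub>R\<^esub>"
    and add: "\<And>x y. x \<oplus>\<^bsub>S\<^esub> y = x \<oplus>\<^bsub>R\<^esub> y" and zero: "\<zero>\<^bsub>S\<^esub> = \<zero>\<^bsub>R\<^esub>"
  shows "cring S"
proof -
  interpret R: cring R by (rule R)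
  note eqs = carrier mult one add zero
  show ?thesis
  proof (rule cringI)
    show "abelian_group S"
    proof (rule abelian_groupI)
      show "\<exists>y\<in>carrier S. y \<oplus>\<^bsub>S\<^esub> x = \<zero>\<^bsub>S\<^esub>" if "x \<in> carrier S" for x
        using that R.l_neg R.a_inv_closed by (metis eqs)
    qed (simp_all add: eqs R.a_ac)
    show "comm_monoid S"
      by (rule comm_monoidI) (simp_all add: eqs R.m_ac)
  qed (simp add: eqs R.l_distr)
qed

text \<open>The product of \<open>free_prod_ring\<close> nests one \<open>frag_extend\<close> inside
  another. Its right argument sits inside the function being extended, so additivity there needs
  linearity in that function.\<close>

lemma frag_extend_diff_fun:
  "frag_extend (\<lambda>p. f p - g p) x = frag_extend f x - frag_extend g x"
proof -
  have "Poly_Mapping.keys x \<subseteq> UNIV" by simp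
  then show ?thesis
    by (induction x rule: frag_induction) (simp_all add: frag_extend_diff)
qed

locale tensor_pair = A: cring A + B: cring B
  for k :: "('a, 'm) ring_scheme" and A :: "('a, 'n) alg_scheme" and B :: "('a, 'p) alg_scheme" +
  assumes infinite_UNIV: "infinite (UNIV :: 'a set)"
    and str_A: "str A \<in> ring_hom k A"
    and str_B: "str B \<in> ring_hom k B"
begin

abbreviation "F \<equiv> free_prod_ring A B"
abbreviation "I \<equiv> tensor_ideal k A B"
abbreviation "Q \<equiv> tensor_quot k A B"
abbreviation "T \<equiv> tensor k A B"
abbreviation "pure \<equiv> pure_tensor k A B"

section \<open>The commutative ring of formal integer combinations of pairs\<close>

lemma free_simps:
  "carrier F = {x. Poly_Mapping.keys x \<subseteq> carrier A \<times> carrier B}"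
  "\<one>\<^bsub>F\<^esub> = frag_of (\<one>\<^bsub>A\<^esub>, \<one>\<^bsub>B\<^esub>)" "\<zero>\<^bsub>F\<^esub> = 0" "x \<oplus>\<^bsub>F\<^esub> y = x + y"
  by (simp_all add: free_prod_ring_def)

lemma free_mult_of:
  "frag_of (a, b) \<otimes>\<^bsub>F\<^esub> frag_of (a', b') = frag_of (a \<otimes>\<^bsub>A\<^esub> a', b \<otimes>\<^bsub>B\<^esub> b')"
  by (simp add: free_prod_ring_def)

text \<open>\<open>frag_extend\<close> is additive on the whole type, so no carrier assumptions
  occur. Differences rather than sums are used to match the induction rule
  \<open>free_induct\<close>.\<close>

lemma free_mult_diff:
  "(x - y) \<otimes>\<^bsub>F\<^esub> z = x \<otimes>\<^bsub>F\<^esub> z - y \<otimes>\<^bsub>F\<^esub> z"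
  "z \<otimes>\<^bsub>F\<^esub> (x - y) = z \<otimes>\<^bsub>F\<^esub> x - z \<otimes>\<^bsub>F\<^esub> y"
  by (simp_all add: free_prod_ring_def frag_extend_diff case_prod_unfold frag_extend_diff_fun)

lemma free_mult_zero: "0 \<otimes>\<^bsub>F\<^esub> z = 0" "z \<otimes>\<^bsub>F\<^esub> 0 = 0"
  using free_mult_diff[of 0 0 z] free_mult_diff[of z 0 0] by simp_all

lemma free_carrier_of: "frag_of (a, b) \<in> carrier F \<longleftrightarrow> a \<in> carrier A \<and> b \<in> carrier B"
  by (simp add: free_simps keys_frag_of)

lemma free_carrier_diff: "x \<in> carrier F \<Longrightarrow> y \<in> carrier F \<Longrightarrow> x - y \<in> carrier F"
  using keys_diff[of x y] by (auto simp: free_simps)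

text \<open>Closure under differences covers sums and negatives at once, so an identity additive in
  each variable is checked on pairs only.\<close>

lemma free_induct [consumes 1, case_names zero one diff]:
  assumes "x \<in> carrier F" and "P 0"
    and "\<And>a b. a \<in> carrier A \<Longrightarrow> b \<in> carrier B \<Longrightarrow> P (frag_of (a, b))"
    and "\<And>x y. x \<in> carrier F \<Longrightarrow> y \<in> carrier F \<Longrightarrow> P x \<Longrightarrow> P y \<Longrightarrow> P (x - y)"
  shows "P x"
proof -
  have "Poly_Mapping.keys x \<subseteq> carrier A \<times> carrier B"
    using assms(1) by (simp add: free_simps)
  then show ?thesis
    by (rule free_Abelian_group_induct) (use assms(2-) in \<open>auto simp: free_simps\<close>)
qed

text \<open>This gives access to the library's commutativity and universal property of the free
  abelian group.\<close>

lemma free_add_monoid: "add_monoid F = free_Abelian_group (carrier A \<times> carrier B)"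
  by (simp add: free_prod_ring_def free_Abelian_group_def)

lemma free_mult_closed:
  assumes "x \<in> carrier F" "y \<in> carrier F"
  shows "x \<otimes>\<^bsub>F\<^esub> y \<in> carrier F"
  using assms(1)
proof (induction rule: free_induct)
  case (one a b)
  from assms(2) show ?case
    by (induction rule: free_induct)
      (use one in \<open>simp_all add: free_mult_zero free_mult_diff free_mult_of free_carrier_of
        free_carrier_diff\<close>, simp add: free_simps)
qed (simp_all add: free_mult_zero free_mult_diff free_carrier_diff, simp add: free_simps)

text \<open>Each law for multiplication is additive in every variable, hence reduces to basis pairs,
  where it is the same law in \<open>A\<close> and \<open>B\<close> componentwise.\<close>

lemma free_cring: "cring F"
proof (rule cringI)
  show "abelian_group F"
    by (rule comm_group_abelian_groupI) (simp only: free_add_monoid abelian_free_Abelian_group)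
  show "comm_monoid F"
  proof (rule comm_monoidI)
    show one: "\<one>\<^bsub>F\<^esub> \<in> carrier F"
      by (simp add: free_simps(2) free_carrier_of)
    fix x y assume x: "x \<in> carrier F" and y: "y \<in> carrier F"
    show "x \<otimes>\<^bsub>F\<^esub> y \<in> carrier F"
      using x y by (rule free_mult_closed)
    show "\<one>\<^bsub>F\<^esub> \<otimes>\<^bsub>F\<^esub> x = x"
      using x by (induction rule: free_induct)
        (simp_all add: free_simps(2) free_mult_zero free_mult_diff free_mult_of)
    show "x \<otimes>\<^bsub>F\<^esub> y = y \<otimes>\<^bsub>F\<^esub> x"
      using x
    proof (induction rule: free_induct)
      case (one a b)
      from y show ?case
        by (induction rule: free_induct)
          (use one in \<open>simp_all add: free_mult_zero free_mult_diff free_mult_of A.m_comm B.m_comm\<close>)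
    qed (simp_all add: free_mult_zero free_mult_diff)
    fix z assume z: "z \<in> carrier F"
    show "x \<otimes>\<^bsub>F\<^esub> y \<otimes>\<^bsub>F\<^esub> z = x \<otimes>\<^bsub>F\<^esub> (y \<otimes>\<^bsub>F\<^esub> z)"
      using x
    proof (induction rule: free_induct)
      case (one a b)
      note ab = this
      from y show ?case
      proof (induction rule: free_induct)
        case (one a' b')
        from z show ?case
          by (induction rule: free_induct)
            (use ab one in \<open>simp_all add: free_mult_zero free_mult_diff free_mult_of
              A.m_assoc B.m_assoc\<close>)
      qed (simp_all add: free_mult_zero free_mult_diff)
    qed (simp_all add: free_mult_zero free_mult_diff)
  qed
  show "(x \<oplus>\<^bsub>F\<^esub> y) \<otimes>\<^bsub>F\<^esub> z = x \<otimes>\<^bsub>F\<^esub> z \<oplus>\<^bsub>F\<^esub> y \<otimes>\<^bsub>F\<^esub> z" for x y z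
    \<comment> \<open>A sum is \<open>x - (- y)\<close> and \<open>- y\<close> is
      \<open>0 - y\<close>, so distributivity over differences suffices.\<close>
    using free_mult_diff(1)[of x "- y" z] free_mult_diff(1)[of 0 y z]
    by (simp add: free_simps free_mult_zero)
qed

sublocale F: cring F by (rule free_cring)

lemma free_minus: "x \<in> carrier F \<Longrightarrow> y \<in> carrier F \<Longrightarrow> x \<ominus>\<^bsub>F\<^esub> y = x - y"
  using free_carrier_diff[of 0 y] F.zero_closed F.minus_equality[of "- y" y]
  by (simp add: a_minus_def free_simps)

section \<open>The quotient by the tensor relations and its copy in the universe\<close>

lemma tensor_rels_subset: "tensor_rels k A B \<subseteq> carrier F"
  using ring_hom_closed[OF str_A] ring_hom_closed[OF str_B]
  by (auto simp: tensor_rels_def intro!: free_carrier_diff simp: free_carrier_of)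

lemma tensor_ideal: "ideal I F"
  unfolding tensor_ideal_def by (rule F.genideal_ideal) (rule tensor_rels_subset)

sublocale I: ideal I F by (rule tensor_ideal)

lemma rcos_eq:
  assumes "x \<in> carrier F" "y \<in> carrier F" "x - y \<in> tensor_rels k A B"
  shows "I +>\<^bsub>F\<^esub> x = I +>\<^bsub>F\<^esub> y"
proof -
  have "x \<ominus>\<^bsub>F\<^esub> y \<in> I"
    using assms F.genideal_self[OF tensor_rels_subset] by (auto simp: free_minus tensor_ideal_def)
  then show ?thesis
    using F.quotient_eq_iff_same_a_r_cos[OF tensor_ideal assms(1,2)] by simp
qed

lemma quot_cring: "cring Q"
  unfolding tensor_quot_def by (rule I.quotient_is_cring) (rule free_cring)

sublocale Q: cring Q by (rule quot_cring)

lemma quot_carrier: "carrier Q = (\<lambda>x. I +>\<^bsub>F\<^esub> x) ` carrier F"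
  by (auto simp: tensor_quot_def FactRing_def A_RCOSETS_def')

lemma rcos_hom: "(\<lambda>x. I +>\<^bsub>F\<^esub> x) \<in> ring_hom F Q"
  unfolding tensor_quot_def by (rule I.rcos_ring_hom)

text \<open>The choice in \<open>tensor_code\<close> needs a witness. The quotient is an image of a
  subset of the free abelian group on all pairs; over an infinite type that group is equipotent to
  the pairs, hence to \<open>'a\<close>.\<close>

lemma inj_code: "inj_on (tensor_code k A B) (carrier Q)"
proof -
  have inf: "infinite (UNIV :: ('a \<times> 'a) set)"
    using infinite_UNIV by (simp add: finite_prod)
  have "carrier Q \<lesssim> carrier F"
    unfolding quot_carrier by (rule image_lepoll)
  also have "\<dots> \<lesssim> carrier (free_Abelian_group (UNIV :: ('a \<times> 'a) set))"
    by (rule subset_imp_lepoll) auto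
  also have "\<dots> \<approx> (UNIV :: ('a \<times> 'a) set)"
    by (rule eqpoll_free_Abelian_group_infinite) (rule inf)
  also have "\<dots> \<approx> (UNIV :: 'a set)"
    using card_of_Times_same_infinite[OF infinite_UNIV]
    by (simp add: eqpoll_iff_card_of_ordIso flip: UNIV_Times_UNIV)
  finally obtain h :: "_ \<Rightarrow> 'a" where "inj_on h (carrier Q)"
    by (auto simp: lepoll_def)
  then show ?thesis
    unfolding tensor_code_def by (rule someI[of "\<lambda>h. inj_on h (carrier Q)"])
qed

lemma decode_code: "x \<in> carrier Q \<Longrightarrow> tensor_decode k A B (tensor_code k A B x) = x"
  unfolding tensor_decode_def by (rule inv_into_f_f) (rule inj_code)

lemma code_iso: "tensor_code k A B \<in> ring_iso Q T"
  by (rule ring_iso_memI)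
    (auto simp: tensor_def decode_code bij_betw_def inj_code)

lemma tensor_cring: "cring T"
  \<comment> \<open>The transported structure is \<open>T\<close> with its zero set to the code of
    zero, which is how \<open>tensor\<close> defines it.\<close>
  using Q.ring_iso_imp_img_cring[OF code_iso] by (simp add: tensor_def)

sublocale T: cring T by (rule tensor_cring)

text \<open>The canonical surjection from \<open>F\<close> onto \<open>T\<close>. Facts about
  \<open>T\<close> are lifted along it to \<open>F\<close>, so that cosets and codes no longer
  appear.\<close>

definition "proj x = tensor_code k A B (I +>\<^bsub>F\<^esub> x)"

lemma proj_hom: "proj \<in> ring_hom F T"
  using ring_hom_trans[OF rcos_hom, of "tensor_code k A B" T] code_iso
  by (simp add: proj_def[abs_def] comp_def ring_iso_def)

lemma tensor_carrier: "carrier T = proj ` carrier F"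
  by (simp add: tensor_def quot_carrier image_image proj_def)

lemma proj_of: "proj (frag_of (a, b)) = pure a b"
  by (simp add: proj_def pure_tensor_def)

text \<open>Since the code is injective on cosets, the kernel of \<open>proj\<close> is exactly the
  tensor ideal.\<close>

lemma proj_eq_iff:
  assumes "x \<in> carrier F" "y \<in> carrier F"
  shows "proj x = proj y \<longleftrightarrow> x \<ominus>\<^bsub>F\<^esub> y \<in> I"
  unfolding proj_def F.quotient_eq_iff_same_a_r_cos[OF tensor_ideal assms]
  using inj_on_eq_iff[OF inj_code] assms by (simp add: quot_carrier)

lemma proj_eqI:
  assumes "x \<in> carrier F" "y \<in> carrier F" "x - y \<in> tensor_rels k A B"
  shows "proj x = proj y"
  using rcos_eq[OF assms] by (simp add: proj_def)

section \<open>Calculus of pure tensors and the two coprojections\<close>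

lemma pure_closed: "a \<in> carrier A \<Longrightarrow> b \<in> carrier B \<Longrightarrow> pure a b \<in> carrier T"
  using ring_hom_closed[OF proj_hom] by (simp add: free_carrier_of flip: proj_of)

lemma pure_mult:
  assumes "a \<in> carrier A" "a' \<in> carrier A" "b \<in> carrier B" "b' \<in> carrier B"
  shows "pure a b \<otimes>\<^bsub>T\<^esub> pure a' b' = pure (a \<otimes>\<^bsub>A\<^esub> a') (b \<otimes>\<^bsub>B\<^esub> b')"
  using assms ring_hom_mult[OF proj_hom] by (simp add: free_carrier_of flip: proj_of free_mult_of)

lemma pure_one: "pure \<one>\<^bsub>A\<^esub> \<one>\<^bsub>B\<^esub> = \<one>\<^bsub>T\<^esub>"
  using ring_hom_one[OF proj_hom] by (simp add: free_simps(2) proj_of)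

lemma pure_add_left:
  assumes "a \<in> carrier A" "a' \<in> carrier A" "b \<in> carrier B"
  shows "pure (a \<oplus>\<^bsub>A\<^esub> a') b = pure a b \<oplus>\<^bsub>T\<^esub> pure a' b"
proof -
  have "proj (frag_of (a \<oplus>\<^bsub>A\<^esub> a', b)) = proj (frag_of (a, b) \<oplus>\<^bsub>F\<^esub> frag_of (a', b))"
    \<comment> \<open>The two arguments of \<open>proj\<close> differ by a generator of the
      ideal.\<close>
    using assms by (intro proj_eqI F.add.m_closed)
      (auto simp: free_carrier_of free_simps(4) tensor_rels_def diff_diff_eq)
  then show ?thesis
    using assms ring_hom_add[OF proj_hom] by (simp add: free_carrier_of proj_of)
qed

lemma pure_add_right:
  assumes "a \<in> carrier A" "b \<in> carrier B" "b' \<in> carrier B"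
  shows "pure a (b \<oplus>\<^bsub>B\<^esub> b') = pure a b \<oplus>\<^bsub>T\<^esub> pure a b'"
proof -
  have "proj (frag_of (a, b \<oplus>\<^bsub>B\<^esub> b')) = proj (frag_of (a, b) \<oplus>\<^bsub>F\<^esub> frag_of (a, b'))"
    using assms by (intro proj_eqI F.add.m_closed)
      (auto simp: free_carrier_of free_simps(4) tensor_rels_def diff_diff_eq)
  then show ?thesis
    using assms ring_hom_add[OF proj_hom] by (simp add: free_carrier_of proj_of)
qed

lemma pure_balanced:
  assumes "c \<in> carrier k" "a \<in> carrier A" "b \<in> carrier B"
  shows "pure (str A c \<otimes>\<^bsub>A\<^esub> a) b = pure a (str B c \<otimes>\<^bsub>B\<^esub> b)"
  using assms ring_hom_closed[OF str_A] ring_hom_closed[OF str_B]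
  unfolding proj_of[symmetric]
  by (intro proj_eqI) (auto simp: free_carrier_of tensor_rels_def)

text \<open>With \<open>inr\<close>, the coprojections that exhibit \<open>T\<close> as the pushout
  of \<open>A\<close> and \<open>B\<close> over \<open>k\<close>.\<close>

definition "inl a = pure a \<one>\<^bsub>B\<^esub>"
definition "inr b = pure \<one>\<^bsub>A\<^esub> b"

lemma inl_hom: "inl \<in> ring_hom A T"
  by (rule ring_hom_memI) (simp_all add: inl_def pure_closed pure_mult pure_add_left pure_one)

lemma inr_hom: "inr \<in> ring_hom B T"
  by (rule ring_hom_memI) (simp_all add: inr_def pure_closed pure_mult pure_add_right pure_one)

lemma pure_eq_inl_inr:
  "a \<in> carrier A \<Longrightarrow> b \<in> carrier B \<Longrightarrow> pure a b = inl a \<otimes>\<^bsub>T\<^esub> inr b"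
  by (simp add: inl_def inr_def pure_mult)

lemma inl_str: "c \<in> carrier k \<Longrightarrow> inl (str A c) = str T c"
  by (simp add: inl_def tensor_def)

text \<open>The structure map of \<open>T\<close> is defined through \<open>A\<close>; balancing at
  the unit tensor moves the scalar to the other factor.\<close>

lemma inr_str: "c \<in> carrier k \<Longrightarrow> inr (str B c) = str T c"
  using pure_balanced[of c "\<one>\<^bsub>A\<^esub>" "\<one>\<^bsub>B\<^esub>"] ring_hom_closed[OF str_A] ring_hom_closed[OF str_B]
  by (simp add: inr_def tensor_def)

lemma tensor_k_algebra: "k_algebra k T"
proof -
  have "inl \<circ> str A \<in> ring_hom k T"
    by (rule ring_hom_trans[OF str_A inl_hom])
  moreover have "inl \<circ> str A = str T"
    by (simp add: fun_eq_iff inl_def tensor_def)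
  ultimately show ?thesis
    by (simp add: k_algebra_def tensor_cring)
qed

section \<open>The universal property of the tensor product\<close>

lemma free_hom_minus:
  assumes "ring C" "h \<in> ring_hom F C" "x \<in> carrier F" "y \<in> carrier F"
  shows "h (x - y) = h x \<ominus>\<^bsub>C\<^esub> h y"
proof -
  interpret ring_hom_ring F C h
    by (intro ring_hom_ringI2 F.ring_axioms assms)
  show ?thesis
    using assms(3,4) by (simp add: a_minus_def flip: free_minus)
qed

text \<open>After composition with the surjection \<open>proj\<close>, both maps are additive on
  \<open>F\<close> and agree on the basis, which generates \<open>F\<close> additively.\<close>

lemma tensor_hom_eqI:
  assumes "ring C" and f: "f \<in> ring_hom T C" and g: "g \<in> ring_hom T C"
    and pure: "\<And>a b. a \<in> carrier A \<Longrightarrow> b \<in> carrier B \<Longrightarrow> f (pure a b) = g (pure a b)"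
    and "t \<in> carrier T"
  shows "f t = g t"
proof -
  interpret C: ring C by fact
  have fp: "f \<circ> proj \<in> ring_hom F C" and gp: "g \<circ> proj \<in> ring_hom F C"
    using ring_hom_trans[OF proj_hom] f g by blast+
  interpret fp: ring_hom_ring F C "f \<circ> proj"
    by (intro ring_hom_ringI2 F.ring_axioms C.ring_axioms fp)
  interpret gp: ring_hom_ring F C "g \<circ> proj"
    by (intro ring_hom_ringI2 F.ring_axioms C.ring_axioms gp)
  have "(f \<circ> proj) x = (g \<circ> proj) x" if "x \<in> carrier F" for x
    using that
  proof (induction rule: free_induct)
    case zero
    then show ?case using fp.hom_zero gp.hom_zero by (simp add: free_simps(3))
  next
    case (one a b)
    then show ?case by (simp add: proj_of pure)
  next
    case (diff x y)
    then show ?case by (simp only: free_hom_minus[OF C.ring_axioms fp] free_hom_minus[OF C.ring_axioms gp])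
  qed
  with \<open>t \<in> carrier T\<close> show ?thesis
    by (auto simp: tensor_carrier)
qed

text \<open>The additive extension exists by freeness. On basis pairs it is multiplicative because
  \<open>C\<close> is commutative, so that \<open>f a\<close>, \<open>g b\<close>,
  \<open>f a'\<close>, \<open>g b'\<close> can be reordered; additivity in both arguments does the
  rest.\<close>

lemma free_hom_exists:
  assumes "cring C" and f: "f \<in> ring_hom A C" and g: "g \<in> ring_hom B C"
  obtains h where "h \<in> ring_hom F C"
    and "\<And>a b. a \<in> carrier A \<Longrightarrow> b \<in> carrier B \<Longrightarrow> h (frag_of (a, b)) = f a \<otimes>\<^bsub>C\<^esub> g b"
proof -
  interpret C: cring C by fact
  interpret f: ring_hom_ring A C f
    by (intro ring_hom_ringI2 A.ring_axioms C.ring_axioms f)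
  interpret g: ring_hom_ring B C g
    by (intro ring_hom_ringI2 B.ring_axioms C.ring_axioms g)
  have "(\<lambda>(a, b). f a \<otimes>\<^bsub>C\<^esub> g b) ` (carrier A \<times> carrier B) \<subseteq> carrier C"
    by auto
  from C.add.free_Abelian_group_universal[OF this] obtain h
    where h: "h \<in> hom (add_monoid F) (add_monoid C)"
      and h': "\<And>p. p \<in> carrier A \<times> carrier B \<Longrightarrow>
        h (frag_of p) = (case p of (a, b) \<Rightarrow> f a \<otimes>\<^bsub>C\<^esub> g b)"
    unfolding free_add_monoid by blast
  have h_of: "h (frag_of (a, b)) = f a \<otimes>\<^bsub>C\<^esub> g b" if "a \<in> carrier A" "b \<in> carrier B" for a b
    using h'[of "(a, b)"] that by simp
  interpret h: abelian_group_hom F C h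
    by (intro abelian_group_homI F.is_abelian_group C.is_abelian_group
        group_hom.intro group_hom_axioms.intro F.add.is_group C.add.is_group h)
  have h_closed: "x \<in> carrier F \<Longrightarrow> h x \<in> carrier C" for x
    by (rule h.hom_closed)
  have h_zero: "h 0 = \<zero>\<^bsub>C\<^esub>"
    using h.hom_zero by (simp add: free_simps(3))
  have h_diff: "x \<in> carrier F \<Longrightarrow> y \<in> carrier F \<Longrightarrow> h (x - y) = h x \<ominus>\<^bsub>C\<^esub> h y" for x y
    by (simp add: a_minus_def h.hom_add h.hom_a_inv flip: free_minus)
  have minus_mult: "(x \<ominus>\<^bsub>C\<^esub> y) \<otimes>\<^bsub>C\<^esub> z = x \<otimes>\<^bsub>C\<^esub> z \<ominus>\<^bsub>C\<^esub> y \<otimes>\<^bsub>C\<^esub> z"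
    "z \<otimes>\<^bsub>C\<^esub> (x \<ominus>\<^bsub>C\<^esub> y) = z \<otimes>\<^bsub>C\<^esub> x \<ominus>\<^bsub>C\<^esub> z \<otimes>\<^bsub>C\<^esub> y"
    if "x \<in> carrier C" "y \<in> carrier C" "z \<in> carrier C" for x y z
    using that by algebra+
  have "h (x \<otimes>\<^bsub>F\<^esub> y) = h x \<otimes>\<^bsub>C\<^esub> h y" if x: "x \<in> carrier F" and y: "y \<in> carrier F" for x y
    using x
  proof (induction rule: free_induct)
    case (one a b)
    from y show ?case
    proof (induction rule: free_induct)
      case (one a' b')
      then show ?case
        using \<open>a \<in> carrier A\<close> \<open>b \<in> carrier B\<close> by (simp add: free_mult_of h_of C.m_ac)
    next
      case (diff x y)
      then show ?case
        using one by (simp add: free_mult_diff h_diff minus_mult h_closed free_mult_closed free_carrier_of)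
    qed (use one in \<open>simp add: free_mult_zero h_zero h_of\<close>)
  next
    case (diff x z)
    then show ?case
      using y by (simp add: free_mult_diff h_diff minus_mult h_closed free_mult_closed)
  qed (use y in \<open>simp add: free_mult_zero h_zero h_closed\<close>)
  then have "h \<in> ring_hom F C"
    by (intro ring_hom_memI h_closed h.hom_add) (simp_all add: free_simps(2) h_of)
  from this h_of show thesis by (rule that)
qed

text \<open>This makes the definite description in \<open>induced\<close> meaningful: existence by
  factoring the map on \<open>F\<close> through \<open>proj\<close>, uniqueness by
  \<open>tensor_hom_eqI\<close>.\<close>

lemma induced_hom:
  assumes "cring C" and f: "f \<in> ring_hom A C" and g: "g \<in> ring_hom B C"
    and str: "\<And>c. c \<in> carrier k \<Longrightarrow> f (str A c) = g (str B c)"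
    and \<phi>: "\<And>a b. a \<in> carrier A \<Longrightarrow> b \<in> carrier B \<Longrightarrow> \<phi> a b = f a \<otimes>\<^bsub>C\<^esub> g b"
  shows "induced k A B C \<phi> \<in> ring_hom T C"
    and "induced k A B C \<phi> \<in> extensional (carrier T)"
    and "\<And>a b. a \<in> carrier A \<Longrightarrow> b \<in> carrier B \<Longrightarrow> induced k A B C \<phi> (pure a b) = \<phi> a b"
proof -
  interpret C: cring C by fact
  interpret f: ring_hom_ring A C f
    by (intro ring_hom_ringI2 A.ring_axioms C.ring_axioms f)
  interpret g: ring_hom_ring B C g
    by (intro ring_hom_ringI2 B.ring_axioms C.ring_axioms g)
  obtain h where h: "h \<in> ring_hom F C"
    and h_of: "\<And>a b. a \<in> carrier A \<Longrightarrow> b \<in> carrier B \<Longrightarrow> h (frag_of (a, b)) = f a \<otimes>\<^bsub>C\<^esub> g b"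
    using free_hom_exists[OF \<open>cring C\<close> f g] by blast
  interpret h: ring_hom_ring F C h
    by (intro ring_hom_ringI2 F.ring_axioms C.ring_axioms h)
  have sA: "str A c \<in> carrier A" and sB: "str B c \<in> carrier B" if "c \<in> carrier k" for c
    using that ring_hom_closed[OF str_A] ring_hom_closed[OF str_B] by auto
  note h_minus = free_hom_minus[OF C.ring_axioms h]
  have r_minus: "x \<ominus>\<^bsub>C\<^esub> x = \<zero>\<^bsub>C\<^esub>" if "x \<in> carrier C" for x
    using that by (simp add: a_minus_def C.r_neg)
  \<comment> \<open>The three kinds of relation vanish by additivity of \<open>f\<close>, by
    additivity of \<open>g\<close>, and by agreement of \<open>f\<close> and \<open>g\<close> on
    scalars, respectively.\<close>
  have "h r = \<zero>\<^bsub>C\<^esub>" if "r \<in> tensor_rels k A B" for r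
    using that unfolding tensor_rels_def
  proof (elim UnE CollectE exE conjE)
    fix a a' b assume "r = frag_of (a \<oplus>\<^bsub>A\<^esub> a', b) - frag_of (a, b) - frag_of (a', b)"
      and ab: "a \<in> carrier A" "a' \<in> carrier A" "b \<in> carrier B"
    then have "h r = (f a \<oplus>\<^bsub>C\<^esub> f a') \<otimes>\<^bsub>C\<^esub> g b \<ominus>\<^bsub>C\<^esub> f a \<otimes>\<^bsub>C\<^esub> g b \<ominus>\<^bsub>C\<^esub> f a' \<otimes>\<^bsub>C\<^esub> g b"
      by (simp add: h_minus h_of free_carrier_of free_carrier_diff)
    moreover have "f a \<in> carrier C" "f a' \<in> carrier C" "g b \<in> carrier C"
      using ab by auto
    ultimately show ?thesis by algebra
  next
    fix a b b' assume "r = frag_of (a, b \<oplus>\<^bsub>B\<^esub> b') - frag_of (a, b) - frag_of (a, b')"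
      and ab: "a \<in> carrier A" "b \<in> carrier B" "b' \<in> carrier B"
    then have "h r = f a \<otimes>\<^bsub>C\<^esub> (g b \<oplus>\<^bsub>C\<^esub> g b') \<ominus>\<^bsub>C\<^esub> f a \<otimes>\<^bsub>C\<^esub> g b \<ominus>\<^bsub>C\<^esub> f a \<otimes>\<^bsub>C\<^esub> g b'"
      by (simp add: h_minus h_of free_carrier_of free_carrier_diff)
    moreover have "f a \<in> carrier C" "g b \<in> carrier C" "g b' \<in> carrier C"
      using ab by auto
    ultimately show ?thesis by algebra
  next
    fix c a b assume "r = frag_of (str A c \<otimes>\<^bsub>A\<^esub> a, b) - frag_of (a, str B c \<otimes>\<^bsub>B\<^esub> b)"
      and ab: "c \<in> carrier k" "a \<in> carrier A" "b \<in> carrier B"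
    then show ?thesis
      by (simp add: h_minus h_of free_carrier_of sA sB str C.m_ac r_minus)
  qed
  then have "tensor_rels k A B \<subseteq> a_kernel F C h"
    using tensor_rels_subset unfolding a_kernel_def' by blast
  then have I_ker: "I \<subseteq> a_kernel F C h"
    unfolding tensor_ideal_def by (rule F.genideal_minimal[OF h.kernel_is_ideal])
  have h_eq: "h x = h y" if x: "x \<in> carrier F" and y: "y \<in> carrier F" and "proj x = proj y" for x y
  proof -
    have "x - y \<in> I"
      using \<open>proj x = proj y\<close> unfolding proj_eq_iff[OF x y] free_minus[OF x y] .
    with I_ker have "x - y \<in> a_kernel F C h"
      by (rule subsetD)
    then have "h x \<ominus>\<^bsub>C\<^esub> h y = \<zero>\<^bsub>C\<^esub>"
      unfolding a_kernel_def' h_minus[OF x y, symmetric] by blast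
    then show ?thesis
      using C.r_right_minus_eq[OF h.hom_closed[OF x] h.hom_closed[OF y]] by blast
  qed
  \<comment> \<open>Any preimage under \<open>proj\<close> may be chosen, since \<open>h_eq\<close>
    makes the value independent of it. The restriction makes the map extensional, as uniqueness
    requires.\<close>
  define F' where "F' = (\<lambda>t \<in> carrier T. h (SOME x. x \<in> carrier F \<and> proj x = t))"
  have F'_proj: "F' (proj x) = h x" if "x \<in> carrier F" for x
  proof -
    define y where "y = (SOME y. y \<in> carrier F \<and> proj y = proj x)"
    have "y \<in> carrier F \<and> proj y = proj x"
      unfolding y_def by (rule someI[of _ x]) (use that in simp)
    then have "h y = h x"
      using h_eq that by blast
    moreover have "F' (proj x) = h y"
      using ring_hom_closed[OF proj_hom that] unfolding F'_def y_def by (rule restrict_apply')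
    ultimately show ?thesis by simp
  qed
  have F'_hom: "F' \<in> ring_hom T C"
  proof (rule ring_hom_memI)
    show "F' \<one>\<^bsub>T\<^esub> = \<one>\<^bsub>C\<^esub>"
      using F'_proj[OF F.one_closed] by (simp add: ring_hom_one[OF proj_hom])
  next
    fix s t assume "s \<in> carrier T" "t \<in> carrier T"
    then obtain x y where xy: "x \<in> carrier F" "y \<in> carrier F" "s = proj x" "t = proj y"
      by (auto simp: tensor_carrier)
    then show "F' (s \<otimes>\<^bsub>T\<^esub> t) = F' s \<otimes>\<^bsub>C\<^esub> F' t" "F' (s \<oplus>\<^bsub>T\<^esub> t) = F' s \<oplus>\<^bsub>C\<^esub> F' t"
      using F'_proj[of "x \<otimes>\<^bsub>F\<^esub> y"] F'_proj[of "x \<oplus>\<^bsub>F\<^esub> y"]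
      by (simp_all add: F'_proj ring_hom_mult[OF proj_hom] ring_hom_add[OF proj_hom])
  qed (auto simp: tensor_carrier F'_proj)
  have F'_ext: "F' \<in> extensional (carrier T)"
    by (simp add: F'_def)
  have F'_pure: "F' (pure a b) = \<phi> a b" if "a \<in> carrier A" "b \<in> carrier B" for a b
    using that F'_proj[of "frag_of (a, b)"] by (simp add: proj_of free_carrier_of h_of \<phi>)
  have unique: "f' = F'" if f': "f' \<in> ring_hom T C" "f' \<in> extensional (carrier T)"
    and f'_pure: "\<And>a b. a \<in> carrier A \<Longrightarrow> b \<in> carrier B \<Longrightarrow> f' (pure a b) = \<phi> a b" for f'
    using f'(2) F'_ext
  proof (rule extensionalityI)
    show "f' t = F' t" if "t \<in> carrier T" for t
      by (rule tensor_hom_eqI[OF C.ring_axioms f'(1) F'_hom _ that]) (simp only: f'_pure F'_pure)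
  qed
  have "\<exists>!f. f \<in> ring_hom T C \<inter> extensional (carrier T) \<and>
      (\<forall>a \<in> carrier A. \<forall>b \<in> carrier B. f (pure a b) = \<phi> a b)"
  proof (rule ex1I)
    show "F' \<in> ring_hom T C \<inter> extensional (carrier T) \<and>
        (\<forall>a \<in> carrier A. \<forall>b \<in> carrier B. F' (pure a b) = \<phi> a b)"
      using F'_hom F'_ext F'_pure by blast
  qed (rule unique, blast+)
  from theI'[OF this] have "induced k A B C \<phi> \<in> ring_hom T C \<inter> extensional (carrier T) \<and>
      (\<forall>a \<in> carrier A. \<forall>b \<in> carrier B. induced k A B C \<phi> (pure a b) = \<phi> a b)"
    unfolding induced_def .
  then show "induced k A B C \<phi> \<in> ring_hom T C"
    and "induced k A B C \<phi> \<in> extensional (carrier T)"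
    and "\<And>a b. a \<in> carrier A \<Longrightarrow> b \<in> carrier B \<Longrightarrow> induced k A B C \<phi> (pure a b) = \<phi> a b"
    by blast+
qed

end

section \<open>Tensor products of \<open>\<sigma>\<close>-algebras\<close>

text \<open>The construction reads only ring fields and \<open>str\<close>. Even the chosen code is
  the same, because the choice is made for the same quotient; hence equality and not just
  isomorphism.\<close>

lemma tensor_sharp:
  "tensor (ring_sharp k) (alg_sharp A) (alg_sharp B) = tensor k A B"
  "pure_tensor (ring_sharp k) (alg_sharp A) (alg_sharp B) = pure_tensor k A B"
  by (simp_all add: fun_eq_iff tensor_def pure_tensor_def tensor_code_def tensor_decode_def
      tensor_quot_def tensor_ideal_def tensor_rels_def free_prod_ring_def alg.defs ring.defs)

lemma alg_sharp_simps:
  "carrier (alg_sharp A) = carrier A" "\<one>\<^bsub>alg_sharp A\<^esub> = \<one>\<^bsub>A\<^esub>"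
  by (simp_all add: alg.defs)

lemma alg_sharp_tensor: "alg_sharp (tensor k A B) = tensor k A B"
  by (simp add: tensor_def alg.defs)

lemma alg_sharp_sigma_tensor': "alg_sharp (sigma_tensor k A B) = tensor k A B"
  by (simp only: alg_sharp_sigma_tensor tensor_sharp)

lemma induced_sharp:
  "induced (ring_sharp k) (alg_sharp A) (alg_sharp B) C = induced k A B C"
  by (rule ext) (simp only: induced_def tensor_sharp alg_sharp_simps)

lemma induced_alg_sharp: "induced k A B (alg_sharp C) = induced k A B C"
proof -
  have "ring_hom (tensor k A B) (alg_sharp C) = ring_hom (tensor k A B) C"
    by (simp add: ring_hom_def alg.defs)
  then show ?thesis
    by (intro ext) (simp only: induced_def)
qed

text \<open>Lets \<open>tensor2\<close> and \<open>sigma_tensor2\<close> replace each other as the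
  left factor of a triple tensor product.\<close>

lemma tensor_left_cong:
  assumes "alg_sharp A = alg_sharp A'"
  shows "tensor k A B = tensor k A' B" "pure_tensor k A B = pure_tensor k A' B"
  unfolding tensor_sharp[of k A B, symmetric] tensor_sharp[of k A' B, symmetric] assms
  by (rule refl)+

lemma tensor3_sharp:
  "tensor3 (ring_sharp k) (alg_sharp A) = tensor3 k A"
  "pure_tensor3 (ring_sharp k) (alg_sharp A) = pure_tensor3 k A"
  using tensor_sharp[of k "tensor2 k A" A]
  by (intro ext | simp only: pure_tensor3_def tensor_sharp alg_sharp_tensor)+

text \<open>Being built from ring data alone, the face maps of both cohomologies are the same
  functions.\<close>

lemma face_maps_sharp:
  "d1 (ring_sharp k) (alg_sharp A) = d1 k A" "d2 (ring_sharp k) (alg_sharp A) = d2 k A"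
  "p1 (ring_sharp k) (alg_sharp A) = p1 k A" "p2 (ring_sharp k) (alg_sharp A) = p2 k A"
  "p3 (ring_sharp k) (alg_sharp A) = p3 k A"
  using tensor_sharp(1)[of k "tensor2 k A" A]
  by (simp_all only: d1_def d2_def p1_def p2_def p3_def tensor_sharp tensor3_sharp induced_sharp
      alg_sharp_simps alg_sharp_tensor)

section \<open>The endomorphism of the tensor product and maps compatible with it\<close>

lemma sigma_tensor_simps:
  "carrier (sigma_tensor k A B) = carrier (tensor k A B)"
  "x \<otimes>\<^bsub>sigma_tensor k A B\<^esub> y = x \<otimes>\<^bsub>tensor k A B\<^esub> y"
  "\<one>\<^bsub>sigma_tensor k A B\<^esub> = \<one>\<^bsub>tensor k A B\<^esub>"
  "x \<oplus>\<^bsub>sigma_tensor k A B\<^esub> y = x \<oplus>\<^bsub>tensor k A B\<^esub> y"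
  "\<zero>\<^bsub>sigma_tensor k A B\<^esub> = \<zero>\<^bsub>tensor k A B\<^esub>"
  "str (sigma_tensor k A B) = str (tensor k A B)"
  "sig (sigma_tensor k A B) =
    induced k A B (tensor k A B) (\<lambda>a b. pure_tensor k A B (sig A a) (sig B b))"
  by (simp_all add: sigma_tensor_def alg.defs salg.defs)

lemma ring_hom_sigma_tensor:
  "ring_hom (sigma_tensor k A B) C = ring_hom (tensor k A B) C"
  "ring_hom C (sigma_tensor k A B) = ring_hom C (tensor k A B)"
  by (simp_all add: ring_hom_def sigma_tensor_simps)

lemma sigma_alg_homD:
  assumes "f \<in> sigma_alg_hom k R S"
  shows "f \<in> ring_hom R S" "f \<in> extensional (carrier R)"
    "c \<in> carrier k \<Longrightarrow> f (str R c) = str S c" "r \<in> carrier R \<Longrightarrow> f (sig R r) = sig S (f r)"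
  using assms by (auto simp: sigma_alg_hom_def alg_hom_def)

lemma sigma_alg_homI:
  assumes "f \<in> ring_hom R S" "f \<in> extensional (carrier R)"
    "\<And>c. c \<in> carrier k \<Longrightarrow> f (str R c) = str S c"
    "\<And>r. r \<in> carrier R \<Longrightarrow> f (sig R r) = sig S (f r)"
  shows "f \<in> sigma_alg_hom k R S"
  using assms by (auto simp: sigma_alg_hom_def alg_hom_def)

lemma k_sigma_algebraD:
  assumes "k_sigma_algebra k R"
  shows "cring R" "str R \<in> ring_hom k R" "sig R \<in> ring_hom R R"
    "c \<in> carrier k \<Longrightarrow> str R (endo k c) = sig R (str R c)"
  using assms by (auto simp: k_sigma_algebra_def k_algebra_def)

lemma sigma_alg_hom_compose:
  assumes R: "k_sigma_algebra k R"
    and f: "f \<in> sigma_alg_hom k R S" and g: "g \<in> sigma_alg_hom k S T"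
  shows "compose (carrier R) g f \<in> sigma_alg_hom k R T"
proof (rule sigma_alg_homI)
  interpret R: cring R by (rule k_sigma_algebraD(1)[OF R])
  have "g \<circ> f \<in> ring_hom R T"
    by (rule ring_hom_trans) (use f g sigma_alg_homD in blast)+
  then show "compose (carrier R) g f \<in> ring_hom R T"
    by (rule R.ring_hom_restrict) (simp add: compose_def)
  show "compose (carrier R) g f \<in> extensional (carrier R)"
    by (rule compose_extensional)
  show "compose (carrier R) g f (str R c) = str T c" if "c \<in> carrier k" for c
    using that ring_hom_closed[OF k_sigma_algebraD(2)[OF R]]
    by (simp add: compose_eq sigma_alg_homD[OF f] sigma_alg_homD[OF g])
  show "compose (carrier R) g f (sig R r) = sig T (compose (carrier R) g f r)"
    if "r \<in> carrier R" for r
    using that ring_hom_closed[OF k_sigma_algebraD(3)[OF R]] ring_hom_closed[OF sigma_alg_homD(1)[OF f]]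
    by (simp add: compose_eq sigma_alg_homD[OF f] sigma_alg_homD[OF g])
qed

locale sigma_tensor_pair =
  fixes k :: "('a, 'm) sring_scheme" and A :: "('a, 'n) salg_scheme" and B :: "('a, 'p) salg_scheme"
  assumes infinite_UNIV: "infinite (UNIV :: 'a set)"
    and k: "sigma_ring k" and A: "k_sigma_algebra k A" and B: "k_sigma_algebra k B"
begin

sublocale tensor_pair k A B
  using infinite_UNIV k_sigma_algebraD[OF A] k_sigma_algebraD[OF B]
  by (simp add: tensor_pair_def tensor_pair_axioms_def)

abbreviation "S \<equiv> sigma_tensor k A B"

lemma sigma_tensor_cring: "cring S"
  by (rule cring_cong[OF tensor_cring]) (simp_all add: sigma_tensor_simps)

text \<open>The endomorphism is induced by \<open>inl \<circ> sig A\<close> and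
  \<open>inr \<circ> sig B\<close>. They agree on a scalar \<open>c\<close>, both sending it to
  \<open>str T (endo k c)\<close>.\<close>

lemma sig_hom: "sig S \<in> ring_hom T T"
  and sig_pure: "\<And>a b. a \<in> carrier A \<Longrightarrow> b \<in> carrier B \<Longrightarrow> sig S (pure a b) = pure (sig A a) (sig B b)"
proof -
  note sA = k_sigma_algebraD(3,4)[OF A] and sB = k_sigma_algebraD(3,4)[OF B]
  have endo: "endo k c \<in> carrier k" if "c \<in> carrier k" for c
    using k that by (auto simp: sigma_ring_def ring_hom_closed)
  have str: "(inl \<circ> sig A) (str A c) = (inr \<circ> sig B) (str B c)" if "c \<in> carrier k" for c
    using inl_str[OF endo[OF that]] inr_str[OF endo[OF that]] sA(2)[OF that] sB(2)[OF that] by simp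
  have pure: "pure (sig A a) (sig B b) = (inl \<circ> sig A) a \<otimes>\<^bsub>T\<^esub> (inr \<circ> sig B) b"
    if "a \<in> carrier A" "b \<in> carrier B" for a b
    using pure_eq_inl_inr[OF ring_hom_closed[OF sA(1) that(1)] ring_hom_closed[OF sB(1) that(2)]]
    by simp
  note ind = induced_hom[OF tensor_cring ring_hom_trans[OF sA(1) inl_hom]
      ring_hom_trans[OF sB(1) inr_hom] str pure]
  show "sig S \<in> ring_hom T T"
    unfolding sigma_tensor_simps by (rule ind(1))
  show "sig S (pure a b) = pure (sig A a) (sig B b)" if "a \<in> carrier A" "b \<in> carrier B" for a b
    using that unfolding sigma_tensor_simps by (intro ind(3))
qed

lemma sigma_tensor_algebra: "k_sigma_algebra k S"
proof -
  \<comment> \<open>A scalar is the pure tensor of \<open>str A c\<close> and one, and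
    \<open>sig B\<close> fixes one.\<close>
  have "str S (endo k c) = sig S (str S c)" if "c \<in> carrier k" for c
    using that sig_pure[of "str A c" "\<one>\<^bsub>B\<^esub>"] ring_hom_closed[OF str_A]
      k_sigma_algebraD(4)[OF A] ring_hom_one[OF k_sigma_algebraD(3)[OF B]]
    by (simp add: sigma_tensor_simps(6)) (simp add: tensor_def)
  moreover have "str S \<in> ring_hom k S"
    using tensor_k_algebra by (simp add: k_algebra_def ring_hom_sigma_tensor sigma_tensor_simps(6))
  ultimately show ?thesis
    by (simp add: k_sigma_algebra_def k_algebra_def sigma_tensor_cring ring_hom_sigma_tensor sig_hom)
qed

text \<open>Stated for the restricted function, since morphisms are extensional; for
  \<open>B = A\<close> it is the body of \<open>d2\<close>, and \<open>inr_sigma_hom\<close> gives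
  that of \<open>d1\<close>.\<close>

lemma inl_sigma_hom: "(\<lambda>a \<in> carrier A. pure a \<one>\<^bsub>B\<^esub>) \<in> sigma_alg_hom k A S"
proof (rule sigma_alg_homI)
  show "(\<lambda>a \<in> carrier A. pure a \<one>\<^bsub>B\<^esub>) \<in> ring_hom A S"
    using inl_hom unfolding ring_hom_sigma_tensor
    by (rule A.ring_hom_restrict) (simp add: inl_def)
next
  fix c assume "c \<in> carrier k"
  then show "(\<lambda>a \<in> carrier A. pure a \<one>\<^bsub>B\<^esub>) (str A c) = str S c"
    using ring_hom_closed[OF str_A] inl_str by (simp add: inl_def sigma_tensor_simps(6))
next
  fix r assume "r \<in> carrier A"
  then show "(\<lambda>a \<in> carrier A. pure a \<one>\<^bsub>B\<^esub>) (sig A r) = sig S ((\<lambda>a \<in> carrier A. pure a \<one>\<^bsub>B\<^esub>) r)"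
    using ring_hom_closed[OF k_sigma_algebraD(3)[OF A]] ring_hom_one[OF k_sigma_algebraD(3)[OF B]]
    by (simp add: sig_pure)
qed simp

lemma inr_sigma_hom: "(\<lambda>b \<in> carrier B. pure \<one>\<^bsub>A\<^esub> b) \<in> sigma_alg_hom k B S"
proof (rule sigma_alg_homI)
  show "(\<lambda>b \<in> carrier B. pure \<one>\<^bsub>A\<^esub> b) \<in> ring_hom B S"
    using inr_hom unfolding ring_hom_sigma_tensor
    by (rule B.ring_hom_restrict) (simp add: inr_def)
next
  fix c assume "c \<in> carrier k"
  then show "(\<lambda>b \<in> carrier B. pure \<one>\<^bsub>A\<^esub> b) (str B c) = str S c"
    using ring_hom_closed[OF str_B] inr_str by (simp add: inr_def sigma_tensor_simps(6))
next
  fix r assume "r \<in> carrier B"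
  then show "(\<lambda>b \<in> carrier B. pure \<one>\<^bsub>A\<^esub> b) (sig B r) = sig S ((\<lambda>b \<in> carrier B. pure \<one>\<^bsub>A\<^esub> b) r)"
    using ring_hom_closed[OF k_sigma_algebraD(3)[OF B]] ring_hom_one[OF k_sigma_algebraD(3)[OF A]]
    by (simp add: sig_pure)
qed simp

lemma induced_sigma_hom:
  assumes C: "k_sigma_algebra k C"
    and u: "u \<in> sigma_alg_hom k A C" and v: "v \<in> sigma_alg_hom k B C"
    and \<phi>: "\<And>a b. a \<in> carrier A \<Longrightarrow> b \<in> carrier B \<Longrightarrow> \<phi> a b = u a \<otimes>\<^bsub>C\<^esub> v b"
  shows "induced k A B C \<phi> \<in> sigma_alg_hom k S C"
proof -
  interpret C: cring C by (rule k_sigma_algebraD(1)[OF C])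
  note u' = sigma_alg_homD[OF u] and v' = sigma_alg_homD[OF v]
  have str: "u (str A c) = v (str B c)" if "c \<in> carrier k" for c
    using that by (simp add: u' v')
  note ind = induced_hom[OF C.is_cring u'(1) v'(1) str \<phi>]
  note sA = k_sigma_algebraD(3)[OF A] and sB = k_sigma_algebraD(3)[OF B]
    and sC = k_sigma_algebraD(3)[OF C]
  show ?thesis
  proof (rule sigma_alg_homI)
    show "induced k A B C \<phi> \<in> ring_hom S C"
      unfolding ring_hom_sigma_tensor by (rule ind(1))
    show "induced k A B C \<phi> \<in> extensional (carrier S)"
      unfolding sigma_tensor_simps by (rule ind(2))
  next
    fix c assume c: "c \<in> carrier k"
    then have "str A c \<in> carrier A" "str C c \<in> carrier C"
      using ring_hom_closed[OF str_A] ring_hom_closed[OF k_sigma_algebraD(2)[OF C]] by auto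
    moreover have "str S c = pure (str A c) \<one>\<^bsub>B\<^esub>"
      using inl_str[OF c] by (simp add: inl_def sigma_tensor_simps(6))
    ultimately show "induced k A B C \<phi> (str S c) = str C c"
      using c by (simp add: ind(3) \<phi> u' ring_hom_one[OF v'(1)])
  next
    fix t assume "t \<in> carrier S"
    then have t: "t \<in> carrier T" by (simp add: sigma_tensor_simps)
    \<comment> \<open>Both composites are ring maps from \<open>T\<close> to \<open>C\<close>, so
      commutation with the endomorphisms need only be seen on pure tensors, where \<open>u\<close>
      and \<open>v\<close> provide it.\<close>
    have pure_case: "(induced k A B C \<phi> \<circ> sig S) (pure a b) = (sig C \<circ> induced k A B C \<phi>) (pure a b)"
      if "a \<in> carrier A" "b \<in> carrier B" for a b
      using that ring_hom_closed[OF sA] ring_hom_closed[OF sB]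
        ring_hom_closed[OF u'(1)] ring_hom_closed[OF v'(1)]
      by (simp add: sig_pure ind(3) \<phi> u' v' ring_hom_mult[OF sC])
    have "(induced k A B C \<phi> \<circ> sig S) t = (sig C \<circ> induced k A B C \<phi>) t"
      by (rule tensor_hom_eqI[OF C.ring_axioms ring_hom_trans[OF sig_hom ind(1)]
            ring_hom_trans[OF ind(1) sC] pure_case t])
    then show "induced k A B C \<phi> (sig S t) = sig C (induced k A B C \<phi> t)"
      by simp
  qed
qed

end

section \<open>The face maps and cohomology\<close>

locale sigma_descent =
  fixes k :: "('a, 'm) sring_scheme" and A :: "'a salg"
  assumes infinite_UNIV: "infinite (UNIV :: 'a set)"
    and k: "sigma_ring k" and A: "k_sigma_algebra k A"
begin

sublocale S2: sigma_tensor_pair k A A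
  by (intro sigma_tensor_pair.intro infinite_UNIV k A)

sublocale S3: sigma_tensor_pair k "sigma_tensor2 k A" A
  by (intro sigma_tensor_pair.intro infinite_UNIV k A S2.sigma_tensor_algebra)

lemma d1_sigma_hom: "d1 k A \<in> sigma_alg_hom k A (sigma_tensor2 k A)"
  unfolding d1_def by (rule S2.inr_sigma_hom)

lemma d2_sigma_hom: "d2 k A \<in> sigma_alg_hom k A (sigma_tensor2 k A)"
  unfolding d2_def by (rule S2.inl_sigma_hom)

text \<open>\<open>sigma_tensor3\<close> has \<open>sigma_tensor2\<close> as left factor, whereas
  \<open>p1\<close>, \<open>p2\<close>, \<open>p3\<close> are defined over \<open>tensor2\<close>;
  this and \<open>induced_tensor3\<close> reconcile the two.\<close>

lemma tensor3_eq:
  "tensor k (sigma_tensor2 k A) A = tensor3 k A"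
  "pure_tensor k (sigma_tensor2 k A) A = pure_tensor k (tensor2 k A) A"
  by (rule tensor_left_cong, simp only: alg_sharp_sigma_tensor' alg_sharp_tensor)+

lemma induced_tensor3:
  "induced k A A (tensor3 k A) \<phi> = induced k A A (sigma_tensor3 k A) \<phi>"
  unfolding induced_alg_sharp[of k A A "sigma_tensor3 k A", symmetric] alg_sharp_sigma_tensor'
    tensor3_eq ..

text \<open>Coprojections into the triple product: \<iota> includes the first two factors and
  \<kappa> the third. Composing \<iota> with \<open>d2\<close> and \<open>d1\<close> gives the
  inclusions of the first and second factor.\<close>

abbreviation "\<iota> \<equiv> (\<lambda>t \<in> carrier (sigma_tensor2 k A). pure_tensor k (sigma_tensor2 k A) A t \<one>\<^bsub>A\<^esub>)"
abbreviation "\<kappa> \<equiv> (\<lambda>a \<in> carrier A. pure_tensor k (sigma_tensor2 k A) A \<one>\<^bsub>sigma_tensor2 k A\<^esub> a)"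

lemma d1_\<iota>: "compose (carrier A) \<iota> (d1 k A) \<in> sigma_alg_hom k A (sigma_tensor3 k A)"
  by (rule sigma_alg_hom_compose[OF A d1_sigma_hom S3.inl_sigma_hom])

lemma d2_\<iota>: "compose (carrier A) \<iota> (d2 k A) \<in> sigma_alg_hom k A (sigma_tensor3 k A)"
  by (rule sigma_alg_hom_compose[OF A d2_sigma_hom S3.inl_sigma_hom])

lemma pure_tensor3_eq:
  assumes "a \<in> carrier A" "b \<in> carrier A" "c \<in> carrier A"
  shows "pure_tensor3 k A a b c = \<iota> (pure_tensor k A A a b) \<otimes>\<^bsub>sigma_tensor3 k A\<^esub> \<kappa> c"
proof -
  have ab: "pure_tensor k A A a b \<in> carrier (sigma_tensor2 k A)"
    unfolding sigma_tensor_simps by (rule S2.pure_closed[OF assms(1,2)])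
  have "pure_tensor3 k A a b c = S3.inl (pure_tensor k A A a b) \<otimes>\<^bsub>sigma_tensor3 k A\<^esub> S3.inr c"
    using S3.pure_eq_inl_inr[OF ab assms(3)]
    by (simp only: pure_tensor3_def tensor3_eq sigma_tensor_simps(2))
  then show ?thesis
    by (simp only: S3.inl_def S3.inr_def restrict_apply'[OF ab] restrict_apply'[OF assms(3)])
qed

text \<open>Each face map is induced by two of the three inclusions of \<open>A\<close>: second and
  third here, first and third for \<open>p2\<close>, first and second for \<open>p3\<close>.\<close>

lemma p1_sigma_hom: "p1 k A \<in> sigma_alg_hom k (sigma_tensor2 k A) (sigma_tensor3 k A)"
  unfolding p1_def induced_tensor3
  by (rule S2.induced_sigma_hom[OF S3.sigma_tensor_algebra d1_\<iota> S3.inr_sigma_hom])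
    (simp only: pure_tensor3_eq S2.A.one_closed compose_eq d1_def restrict_apply')

lemma p2_sigma_hom: "p2 k A \<in> sigma_alg_hom k (sigma_tensor2 k A) (sigma_tensor3 k A)"
  unfolding p2_def induced_tensor3
  by (rule S2.induced_sigma_hom[OF S3.sigma_tensor_algebra d2_\<iota> S3.inr_sigma_hom])
    (simp only: pure_tensor3_eq S2.A.one_closed compose_eq d2_def restrict_apply')

lemma p3_sigma_hom: "p3 k A \<in> sigma_alg_hom k (sigma_tensor2 k A) (sigma_tensor3 k A)"
  unfolding p3_def induced_tensor3
proof (rule S2.induced_sigma_hom[OF S3.sigma_tensor_algebra d2_\<iota>])
  show "compose (carrier A) \<iota> (d1 k A) \<in> sigma_alg_hom k A (sigma_tensor3 k A)"
    by (rule d1_\<iota>)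
  fix a b assume ab: "a \<in> carrier A" "b \<in> carrier A"
  let ?a = "pure_tensor k A A a \<one>\<^bsub>A\<^esub>" and ?b = "pure_tensor k A A \<one>\<^bsub>A\<^esub> b"
  have "pure_tensor k A A a b = ?a \<otimes>\<^bsub>sigma_tensor2 k A\<^esub> ?b"
    using S2.pure_eq_inl_inr[OF ab] by (simp add: S2.inl_def S2.inr_def sigma_tensor_simps)
  moreover have "?a \<in> carrier (sigma_tensor2 k A)" "?b \<in> carrier (sigma_tensor2 k A)"
    using ab S2.pure_closed by (simp_all add: sigma_tensor_simps)
  \<comment> \<open>Here both factors lie in the left part of the bracketing, so the splitting is
    done in the double product and pushed forward by the ring map \<open>S3.inl\<close>.\<close>
  ultimately have "S3.inl (pure_tensor k A A a b) = S3.inl ?a \<otimes>\<^bsub>sigma_tensor3 k A\<^esub> S3.inl ?b"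
    using ring_hom_mult[OF S3.inl_hom] by (simp add: sigma_tensor_simps)
  then show "pure_tensor3 k A a b \<one>\<^bsub>A\<^esub> =
      compose (carrier A) \<iota> (d2 k A) a \<otimes>\<^bsub>sigma_tensor3 k A\<^esub> compose (carrier A) \<iota> (d1 k A) b"
    using ab S2.pure_closed
    by (simp add: pure_tensor3_def compose_eq d1_def d2_def S3.inl_def tensor3_eq sigma_tensor_simps)
qed

end

theorem proposition3p5:
  fixes k :: "'a sring"
    and \<G> :: "('a alg, 'a, 'g) grp_functor"
    and G :: "('a salg, 'a, 'g) grp_functor"
    and A :: "'a salg"
  assumes universe: "infinite (UNIV :: 'a set)"
    and k: "sigma_ring k"
    and alg_grp: "algebraic_group (ring_sharp k) \<G>"
    and sigma_alg_grp: "sigma_algebraic_group k G"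
    and corresponding_ob:
      "\<And>R. k_sigma_algebra k R \<Longrightarrow> ob G R = ob \<G> (alg_sharp R)"
    and corresponding_mor:
      "\<And>R S f x. \<lbrakk>k_sigma_algebra k R; k_sigma_algebra k S; f \<in> sigma_alg_hom k R S;
         x \<in> carrier (ob G R)\<rbrakk> \<Longrightarrow> mor G R S f x = mor \<G> (alg_sharp R) (alg_sharp S) f x"
    and A: "k_sigma_algebra k A"
  shows "H1_sigma k A G = H1 (ring_sharp k) (alg_sharp A) \<G>"
proof -
  interpret sigma_descent k A
    by (intro sigma_descent.intro universe k A)
  let ?S2 = "sigma_tensor2 k A" and ?S3 = "sigma_tensor3 k A"
  let ?k = "ring_sharp k" and ?A = "alg_sharp A"
  note S2 = S2.sigma_tensor_algebra and S3 = S3.sigma_tensor_algebra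
  have sharp: "alg_sharp ?S2 = tensor2 ?k ?A" "alg_sharp ?S3 = tensor3 ?k ?A"
    by (simp_all only: alg_sharp_sigma_tensor)
  note ob_eq = corresponding_ob[OF A] corresponding_ob[OF S2, unfolded sharp]
    corresponding_ob[OF S3, unfolded sharp]
  have p_eq: "mor G ?S2 ?S3 (p1 k A) \<chi> = mor \<G> (tensor2 ?k ?A) (tensor3 ?k ?A) (p1 ?k ?A) \<chi>"
    "mor G ?S2 ?S3 (p2 k A) \<chi> = mor \<G> (tensor2 ?k ?A) (tensor3 ?k ?A) (p2 ?k ?A) \<chi>"
    "mor G ?S2 ?S3 (p3 k A) \<chi> = mor \<G> (tensor2 ?k ?A) (tensor3 ?k ?A) (p3 ?k ?A) \<chi>"
    if "\<chi> \<in> carrier (ob G ?S2)" for \<chi>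
    using corresponding_mor[OF S2 S3 p1_sigma_hom that] corresponding_mor[OF S2 S3 p2_sigma_hom that]
      corresponding_mor[OF S2 S3 p3_sigma_hom that]
    by (simp_all only: sharp face_maps_sharp)
  have d_eq: "mor G A ?S2 (d1 k A) \<alpha> = mor \<G> ?A (tensor2 ?k ?A) (d1 ?k ?A) \<alpha>"
    "mor G A ?S2 (d2 k A) \<alpha> = mor \<G> ?A (tensor2 ?k ?A) (d2 ?k ?A) \<alpha>"
    if "\<alpha> \<in> carrier (ob G A)" for \<alpha>
    using corresponding_mor[OF A S2 d1_sigma_hom that] corresponding_mor[OF A S2 d2_sigma_hom that]
    by (simp_all only: sharp face_maps_sharp)
  have Z_eq: "Z1_sigma k A G = Z1 ?k ?A \<G>"
    unfolding Z1_sigma_def Z1_def Let_def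
    \<comment> \<open>The congruence rule supplies membership in the carrier, on which
      \<open>p_eq\<close> depends.\<close>
    by (intro Collect_cong conj_cong) (simp_all add: ob_eq flip: p_eq)
  \<comment> \<open>The twist by \<alpha> is applied to the second component in
    \<open>equiv_sigma\<close> but to the first in \<open>equiv_coc\<close>.\<close>
  have flipped: "equiv_sigma k A G = (equiv_coc ?k ?A \<G>)\<inverse>"
    unfolding equiv_sigma_def equiv_coc_def Let_def converse_unfold Z_eq
    using d_eq by (auto simp: ob_eq)
  have G_functor: "group_valued_functor (k_sigma_algebra k) (sigma_alg_hom k) G"
    using sigma_alg_grp by (simp add: sigma_algebraic_group_def)
  interpret GA: group "ob G A"
    using G_functor A by (simp add: group_valued_functor_def)
  interpret G2: group "ob G ?S2"
    using G_functor S2 by (simp add: group_valued_functor_def)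
  interpret \<delta>1: group_hom "ob G A" "ob G ?S2" "mor G A ?S2 (d1 k A)"
    by unfold_locales (use G_functor A S2 d1_sigma_hom in \<open>auto simp: group_valued_functor_def\<close>)
  interpret \<delta>2: group_hom "ob G A" "ob G ?S2" "mor G A ?S2 (d2 k A)"
    by unfold_locales (use G_functor A S2 d2_sigma_hom in \<open>auto simp: group_valued_functor_def\<close>)
  \<comment> \<open>The inverse of \<alpha> undoes the twist, because the maps induced by
    \<open>d1\<close> and \<open>d2\<close> are group homomorphisms.\<close>
  have "sym (equiv_sigma k A G)"
  proof (rule symI)
    fix \<chi> \<psi> assume "(\<chi>, \<psi>) \<in> equiv_sigma k A G"
    then obtain \<alpha> where Z: "\<chi> \<in> Z1_sigma k A G" "\<psi> \<in> Z1_sigma k A G"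
      and \<alpha>: "\<alpha> \<in> carrier (ob G A)"
      and eq: "\<chi> = mor G A ?S2 (d1 k A) \<alpha> \<otimes>\<^bsub>ob G ?S2\<^esub> \<psi> \<otimes>\<^bsub>ob G ?S2\<^esub>
        inv\<^bsub>ob G ?S2\<^esub> (mor G A ?S2 (d2 k A) \<alpha>)"
      by (auto simp: equiv_sigma_def Let_def)
    have \<psi>: "\<psi> \<in> carrier (ob G ?S2)"
      using Z(2) by (simp add: Z1_sigma_def Let_def)
    have "\<psi> = mor G A ?S2 (d1 k A) (inv\<^bsub>ob G A\<^esub> \<alpha>) \<otimes>\<^bsub>ob G ?S2\<^esub> \<chi> \<otimes>\<^bsub>ob G ?S2\<^esub>
        inv\<^bsub>ob G ?S2\<^esub> (mor G A ?S2 (d2 k A) (inv\<^bsub>ob G A\<^esub> \<alpha>))"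
      using \<alpha> \<psi> by (simp add: eq G2.m_assoc G2.inv_solve_left)
    then show "(\<psi>, \<chi>) \<in> equiv_sigma k A G"
      using Z \<alpha> by (auto simp: equiv_sigma_def Let_def intro!: bexI[of _ "inv\<^bsub>ob G A\<^esub> \<alpha>"])
  qed
  then have "equiv_sigma k A G = equiv_coc ?k ?A \<G>"
    unfolding flipped by (simp add: sym_conv_converse_eq)
  then show ?thesis
    by (simp add: H1_sigma_def H1_def Z_eq ob_eq)
qed

end
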